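(* Let $\mathcal{C}: Sym \to Sym$ be a symmetric and positive definite fourth-order tensor. For every $\mathbf{D}\in Sym$, there exists a unique $\mathbf{Y}^*\in Sym^{-}$ satisfying the following three equivalent statements: (i) $\mathbf{Y}^*$ minimizes over $Sym^{-}$ the functional $\phi(\mathbf{Y})=(\mathbf{D}-\mathbf{Y})\bullet\mathcal{C}(\mathbf{D}-\mathbf{Y})$, i.e. $\phi(\mathbf{Y}^* )\le\phi(\mathbf{Y})$ for each $\mathbf{Y}\in Sym^{-}$. (ii) $\mathbf{Y}^*$ satisfies the complementarity problem $$\mathcal{C}(\mathbf{D}-\mathbf{Y}^* )\in Sym^{+},\qquad \mathbf{Y}^*\bullet\mathcal{C}(\mathbf{D}-\mathbf{Y}^* )=0.$$ (iii) $\mathbf{Y}^*$ satisfies the variational inequality $$\mathcal{C}(\mathbf{D}-\mathbf{Y}^* )\bullet(\mathbf{Y}-\mathbf{Y}^* )\le 0\quad\text{for all }\mathbf{Y}\in Sym^{-}.$$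
   Context: Let $\mathcal{V}$ be a real inner product space of dimension 3. $Lin$ is the space of second-order tensors (linear maps $\mathcal{V}\to\mathcal{V}$) with inner product $\mathbf{A}\bullet\mathbf{B}=\mathrm{tr}(\mathbf{A}^T\mathbf{B})$. $Sym\subset Lin$ is the subspace of symmetric tensors; $Sym^{-}$ and $Sym^{+}$ are the sets of negative semidefinite and positive semidefinite elements of $Sym$, respectively. A fourth-order tensor $\mathcal{C}$ from $Sym$ to $Sym$ is a linear map $Sym\to Sym$; it is symmetric if $\mathbf{A}\bullet\mathcal{C}(\mathbf{B})=\mathbf{B}\bullet\mathcal{C}(\mathbf{A})$ for all $\mathbf{A},\mathbf{B}\in Sym$, and positive definite if $\mathbf{A}\bullet\mathcal{C}(\mathbf{A})>0$ for all nonzero $\mathbf{A}\in Sym$. The equivalence of (i), (ii), (iii) is understood for elements $\mathbf{Y}^*\in Sym^{-}$. *)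

theory Defs
  imports "HOL-Analysis.Analysis"
begin

(* Second-order tensors over a Euclidean space 'v are elements of the type 'v \<Rightarrow>\<^sub>L 'v:
   in finite dimension every linear map is bounded, and this type carries the vector space
   structure. Its library norm (the operator norm) is not the norm induced by tensor_inner
   and plays no role here. *)

definition tensor_transpose :: "('v::euclidean_space \<Rightarrow>\<^sub>L 'v) \<Rightarrow> ('v \<Rightarrow>\<^sub>L 'v)" where
  "tensor_transpose A = Blinfun (adjoint (blinfun_apply A))"

(* Basis is orthonormal, so the diagonal entries of A in that basis are A b \<bullet> b. *)
definition tensor_trace :: "('v::euclidean_space \<Rightarrow>\<^sub>L 'v) \<Rightarrow> real" where
  "tensor_trace A = (\<Sum>b\<in>Basis. blinfun_apply A b \<bullet> b)"

definition tensor_inner ::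
    "('v::euclidean_space \<Rightarrow>\<^sub>L 'v) \<Rightarrow> ('v \<Rightarrow>\<^sub>L 'v) \<Rightarrow> real"  (infix "\<bullet>\<^sub>T" 70) where
  "A \<bullet>\<^sub>T B = tensor_trace (tensor_transpose A o\<^sub>L B)"

definition Sym :: "('v::euclidean_space \<Rightarrow>\<^sub>L 'v) set" where
  "Sym = {A. tensor_transpose A = A}"

definition Sym_pos :: "('v::euclidean_space \<Rightarrow>\<^sub>L 'v) set" where
  "Sym_pos = {A \<in> Sym. \<forall>x. x \<bullet> blinfun_apply A x \<ge> 0}"

definition Sym_neg :: "('v::euclidean_space \<Rightarrow>\<^sub>L 'v) set" where
  "Sym_neg = {A \<in> Sym. \<forall>x. x \<bullet> blinfun_apply A x \<le> 0}"

(* A linear map from Sym to Sym is represented by a total function on all tensors;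
   its values outside Sym are unconstrained and never used. *)
definition fourth_order_tensor ::
    "(('v::euclidean_space \<Rightarrow>\<^sub>L 'v) \<Rightarrow> ('v \<Rightarrow>\<^sub>L 'v)) \<Rightarrow> bool" where
  "fourth_order_tensor C \<longleftrightarrow>
     (\<forall>A\<in>Sym. C A \<in> Sym) \<and>
     (\<forall>A\<in>Sym. \<forall>B\<in>Sym. C (A + B) = C A + C B) \<and>
     (\<forall>r. \<forall>A\<in>Sym. C (r *\<^sub>R A) = r *\<^sub>R C A)"

definition symmetric_tensor4 ::
    "(('v::euclidean_space \<Rightarrow>\<^sub>L 'v) \<Rightarrow> ('v \<Rightarrow>\<^sub>L 'v)) \<Rightarrow> bool" where
  "symmetric_tensor4 C \<longleftrightarrow> (\<forall>A\<in>Sym. \<forall>B\<in>Sym. A \<bullet>\<^sub>T C B = B \<bullet>\<^sub>T C A)"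

definition positive_definite_tensor4 ::
    "(('v::euclidean_space \<Rightarrow>\<^sub>L 'v) \<Rightarrow> ('v \<Rightarrow>\<^sub>L 'v)) \<Rightarrow> bool" where
  "positive_definite_tensor4 C \<longleftrightarrow> (\<forall>A\<in>Sym. A \<noteq> 0 \<longrightarrow> A \<bullet>\<^sub>T C A > 0)"

definition phi ::
    "(('v::euclidean_space \<Rightarrow>\<^sub>L 'v) \<Rightarrow> ('v \<Rightarrow>\<^sub>L 'v)) \<Rightarrow> ('v \<Rightarrow>\<^sub>L 'v) \<Rightarrow> ('v \<Rightarrow>\<^sub>L 'v) \<Rightarrow> real" where
  "phi C D Y = (D - Y) \<bullet>\<^sub>T C (D - Y)"

definition is_minimizer ::
    "(('v::euclidean_space \<Rightarrow>\<^sub>L 'v) \<Rightarrow> ('v \<Rightarrow>\<^sub>L 'v)) \<Rightarrow> ('v \<Rightarrow>\<^sub>L 'v) \<Rightarrow> ('v \<Rightarrow>\<^sub>L 'v) \<Rightarrow> bool" where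
  "is_minimizer C D Ys \<longleftrightarrow> (\<forall>Y\<in>Sym_neg. phi C D Ys \<le> phi C D Y)"

definition solves_complementarity ::
    "(('v::euclidean_space \<Rightarrow>\<^sub>L 'v) \<Rightarrow> ('v \<Rightarrow>\<^sub>L 'v)) \<Rightarrow> ('v \<Rightarrow>\<^sub>L 'v) \<Rightarrow> ('v \<Rightarrow>\<^sub>L 'v) \<Rightarrow> bool" where
  "solves_complementarity C D Ys \<longleftrightarrow> C (D - Ys) \<in> Sym_pos \<and> Ys \<bullet>\<^sub>T C (D - Ys) = 0"

definition solves_variational_inequality ::
    "(('v::euclidean_space \<Rightarrow>\<^sub>L 'v) \<Rightarrow> ('v \<Rightarrow>\<^sub>L 'v)) \<Rightarrow> ('v \<Rightarrow>\<^sub>L 'v) \<Rightarrow> ('v \<Rightarrow>\<^sub>L 'v) \<Rightarrow> bool" where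
  "solves_variational_inequality C D Ys \<longleftrightarrow> (\<forall>Y\<in>Sym_neg. C (D - Ys) \<bullet>\<^sub>T (Y - Ys) \<le> 0)"

lemma blinfun_apply_tensor_transpose:
  "blinfun_apply (tensor_transpose A) = adjoint (blinfun_apply A)"
proof -
  have "linear (adjoint (blinfun_apply A))"
    by (intro adjoint_linear bounded_linear.linear blinfun.bounded_linear_right)
  then show ?thesis
    unfolding tensor_transpose_def
    by (simp add: bounded_linear_Blinfun_apply linear_conv_bounded_linear)
qed

lemma tensor_transpose_works:
  "x \<bullet> blinfun_apply (tensor_transpose A) y = blinfun_apply A x \<bullet> y"
  unfolding blinfun_apply_tensor_transpose
  by (intro adjoint_works bounded_linear.linear blinfun.bounded_linear_right)

lemma tensor_inner_alt:
  "A \<bullet>\<^sub>T B = (\<Sum>b\<in>Basis. blinfun_apply A b \<bullet> blinfun_apply B b)"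
proof -
  have "blinfun_apply (tensor_transpose A o\<^sub>L B) b \<bullet> b = blinfun_apply A b \<bullet> blinfun_apply B b" for b
    using tensor_transpose_works[of b A "blinfun_apply B b"]
    by (simp add: inner_commute[of _ b])
  then show ?thesis
    unfolding tensor_inner_def tensor_trace_def by simp
qed

lemma Sym_iff:
  "A \<in> Sym \<longleftrightarrow> (\<forall>x y. blinfun_apply A x \<bullet> y = x \<bullet> blinfun_apply A y)"
proof
  assume "A \<in> Sym"
  then have "tensor_transpose A = A" by (simp add: Sym_def)
  then show "\<forall>x y. blinfun_apply A x \<bullet> y = x \<bullet> blinfun_apply A y"
    using tensor_transpose_works[of _ A] by simp
next
  assume h: "\<forall>x y. blinfun_apply A x \<bullet> y = x \<bullet> blinfun_apply A y"
  have "tensor_transpose A = A"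
  proof (rule blinfun_eqI)
    fix y
    show "blinfun_apply (tensor_transpose A) y = blinfun_apply A y"
      by (rule vector_eq_ldot[THEN iffD1]) (simp add: tensor_transpose_works h)
  qed
  then show "A \<in> Sym" by (simp add: Sym_def)
qed

lemma subspace_Sym: "subspace Sym"
  by (auto simp: subspace_def Sym_iff blinfun.bilinear_simps inner_simps)

end

theory Submission
  imports Defs
begin

text \<open>On \<open>Sym\<close>, \<open>C\<close> coincides with a continuous map, so by compactness of the unit sphere its
  quadratic form is coercive and a minimizer exists. The identity \<open>phi_diff\<close> then gives
  uniqueness and, restricted to segments, the equivalence of (i) and (iii). As \<open>Sym_neg\<close> is a
  cone, (iii) says that \<open>C (D - Ys)\<close> is orthogonal to \<open>Ys\<close> and lies in the polar cone of
  \<open>Sym_neg\<close>, and this polar cone is \<open>Sym_pos\<close>. The inclusion needing an argument,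
  \<open>P \<bullet>\<^sub>T Y \<le> 0\<close> for \<open>P \<in> Sym_pos\<close> and \<open>Y \<in> Sym_neg\<close>, follows by splitting \<open>P\<close> into dyads
  \<open>u u\<^sup>T\<close> as in the Cholesky decomposition, which avoids the spectral theorem.\<close>

section \<open>The tensor inner product and dyads\<close>

lemma tensor_inner_commute: "A \<bullet>\<^sub>T B = B \<bullet>\<^sub>T A"
  by (simp add: tensor_inner_alt inner_commute)

lemma tensor_inner_add_left: "(A + B) \<bullet>\<^sub>T X = A \<bullet>\<^sub>T X + B \<bullet>\<^sub>T X"
  by (simp add: tensor_inner_alt blinfun.bilinear_simps inner_simps sum.distrib)

lemma tensor_inner_add_right: "X \<bullet>\<^sub>T (A + B) = X \<bullet>\<^sub>T A + X \<bullet>\<^sub>T B"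
  by (simp add: tensor_inner_alt blinfun.bilinear_simps inner_simps sum.distrib)

lemma tensor_inner_diff_left: "(A - B) \<bullet>\<^sub>T X = A \<bullet>\<^sub>T X - B \<bullet>\<^sub>T X"
  by (simp add: tensor_inner_alt blinfun.bilinear_simps inner_simps sum_subtractf)

lemma tensor_inner_diff_right: "X \<bullet>\<^sub>T (A - B) = X \<bullet>\<^sub>T A - X \<bullet>\<^sub>T B"
  by (simp add: tensor_inner_alt blinfun.bilinear_simps inner_simps sum_subtractf)

lemma tensor_inner_scaleR_left: "(r *\<^sub>R A) \<bullet>\<^sub>T X = r * (A \<bullet>\<^sub>T X)"
  by (simp add: tensor_inner_alt blinfun.bilinear_simps sum_distrib_left)

lemma tensor_inner_scaleR_right: "X \<bullet>\<^sub>T (r *\<^sub>R A) = r * (X \<bullet>\<^sub>T A)"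
  by (simp add: tensor_inner_alt blinfun.bilinear_simps sum_distrib_left)

lemmas tensor_inner_simps = tensor_inner_add_left tensor_inner_add_right
  tensor_inner_diff_left tensor_inner_diff_right
  tensor_inner_scaleR_left tensor_inner_scaleR_right

lemma continuous_on_tensor_inner [continuous_intros]:
  assumes "continuous_on S f" "continuous_on S g"
  shows "continuous_on S (\<lambda>x. f x \<bullet>\<^sub>T g x)"
  unfolding tensor_inner_alt using assms by (intro continuous_intros)

text \<open>The tensor product \<open>u v^T\<close>, composed from bounded linear maps so that
  boundedness needs no separate proof.\<close>

definition dyad :: "'v::euclidean_space \<Rightarrow> 'v \<Rightarrow> ('v \<Rightarrow>\<^sub>L 'v)" where
  "dyad u v = blinfun_scaleR_left u o\<^sub>L blinfun_inner_left v"

lemma dyad_apply [simp]: "blinfun_apply (dyad u v) x = (v \<bullet> x) *\<^sub>R u"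
  by (simp add: dyad_def inner_commute)

lemma dyad_self_in_Sym: "dyad u u \<in> Sym"
  by (simp add: Sym_iff inner_commute)

text \<open>This links the two cones to the inner product: pairing with \<open>dyad u u\<close>
  evaluates the quadratic form of \<open>A\<close> at \<open>u\<close>.\<close>

lemma tensor_inner_dyad: "A \<bullet>\<^sub>T dyad u v = u \<bullet> blinfun_apply A v"
proof -
  have "A \<bullet>\<^sub>T dyad u v = u \<bullet> (\<Sum>b\<in>Basis. (v \<bullet> b) *\<^sub>R blinfun_apply A b)"
    by (simp add: tensor_inner_alt inner_sum_right inner_commute)
  also have "(\<Sum>b\<in>Basis. (v \<bullet> b) *\<^sub>R blinfun_apply A b) = blinfun_apply A (\<Sum>b\<in>Basis. (v \<bullet> b) *\<^sub>R b)"
    by (simp add: blinfun.bilinear_simps blinfun.sum_right)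
  finally show ?thesis
    by (simp add: euclidean_representation)
qed

section \<open>The semidefinite cones\<close>

lemma Sym_neg_imp_Sym: "A \<in> Sym_neg \<Longrightarrow> A \<in> Sym"
  by (simp add: Sym_neg_def)

lemma zero_in_Sym_neg: "0 \<in> Sym_neg"
  by (simp add: Sym_neg_def subspace_0 subspace_Sym)

lemma Sym_neg_add: "A \<in> Sym_neg \<Longrightarrow> B \<in> Sym_neg \<Longrightarrow> A + B \<in> Sym_neg"
  by (simp add: Sym_neg_def subspace_add[OF subspace_Sym] blinfun.bilinear_simps inner_simps
      add_nonpos_nonpos)

lemma Sym_neg_scaleR: "A \<in> Sym_neg \<Longrightarrow> r \<ge> 0 \<Longrightarrow> r *\<^sub>R A \<in> Sym_neg"
  by (simp add: Sym_neg_def subspace_scale[OF subspace_Sym] blinfun.bilinear_simps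
      mult_nonneg_nonpos)

lemma closed_Sym: "closed (Sym :: ('v::euclidean_space \<Rightarrow>\<^sub>L 'v) set)"
proof -
  have *: "Sym = (\<Inter>x. \<Inter>y. {A :: 'v \<Rightarrow>\<^sub>L 'v. blinfun_apply A x \<bullet> y = x \<bullet> blinfun_apply A y})"
    by (auto simp: Sym_iff)
  show ?thesis
    unfolding * by (intro closed_INT ballI closed_Collect_eq continuous_intros)
qed

lemma closed_Sym_neg: "closed (Sym_neg :: ('v::euclidean_space \<Rightarrow>\<^sub>L 'v) set)"
proof -
  have *: "Sym_neg = Sym \<inter> (\<Inter>x. {A :: 'v \<Rightarrow>\<^sub>L 'v. x \<bullet> blinfun_apply A x \<le> 0})"
    by (auto simp: Sym_neg_def)
  show ?thesis
    unfolding * by (intro closed_Int closed_Sym closed_INT ballI closed_Collect_le continuous_intros)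
qed

text \<open>The form of \<open>P\<close> at \<open>x + t y\<close> is a quadratic polynomial in
  \<open>t\<close> that is never negative; a suitable \<open>t\<close> yields the bound.\<close>

lemma Sym_pos_cauchy_schwarz:
  assumes "P \<in> Sym_pos"
  shows "(x \<bullet> blinfun_apply P y)\<^sup>2 \<le> (x \<bullet> blinfun_apply P x) * (y \<bullet> blinfun_apply P y)"
proof -
  let ?a = "x \<bullet> blinfun_apply P x" and ?b = "x \<bullet> blinfun_apply P y"
    and ?c = "y \<bullet> blinfun_apply P y"
  have sym: "y \<bullet> blinfun_apply P x = ?b"
    using assms by (metis (no_types, lifting) Sym_iff Sym_pos_def inner_commute mem_Collect_eq)
  have pos: "z \<bullet> blinfun_apply P z \<ge> 0" for z
    using assms by (simp add: Sym_pos_def)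
  have quad: "?a + 2 * t * ?b + t\<^sup>2 * ?c \<ge> 0" for t
    using pos[of "x + t *\<^sub>R y"] sym
    by (simp add: blinfun.bilinear_simps inner_simps power2_eq_square algebra_simps)
  show ?thesis
  proof (cases "?c = 0")
    case True
    have "?b = 0"
    proof (rule ccontr)
      assume "?b \<noteq> 0"
      \<comment> \<open>With \<open>?c = 0\<close> the polynomial is affine in \<open>t\<close>, and
        this \<open>t\<close> gives it the value -1.\<close>
      then show False
        using quad[of "- (?a + 1) / (2 * ?b)"] True pos[of x] by (simp add: field_simps)
    qed
    then show ?thesis
      using True by simp
  next
    case False
    then have "?c > 0"
      using pos[of y] by simp
    \<comment> \<open>The minimum over \<open>t\<close> is attained at
      \<open>- ?b / ?c\<close>.\<close>
    then show ?thesis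
      using quad[of "- ?b / ?c"] by (simp add: field_simps power2_eq_square)
  qed
qed

text \<open>One step of Cholesky elimination: subtracting a suitable multiple of the dyad of
  \<open>P b\<close> leaves a positive semidefinite tensor that annihilates \<open>b\<close>.
  If \<open>b \<bullet> P b = 0\<close>, then \<open>P b = 0\<close> and the division by zero is harmless.\<close>

lemma Sym_pos_eliminate:
  fixes P :: "'v::euclidean_space \<Rightarrow>\<^sub>L 'v" and b :: 'v
  assumes P: "P \<in> Sym_pos"
  defines "u \<equiv> blinfun_apply P b"
  defines "Q \<equiv> P - (1 / (b \<bullet> u)) *\<^sub>R dyad u u"
  shows "Q \<in> Sym_pos" "blinfun_apply Q b = 0"
    "\<And>x. blinfun_apply P x = 0 \<Longrightarrow> blinfun_apply Q x = 0"
proof -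
  have symP: "P \<in> Sym" and pos: "\<And>z. z \<bullet> blinfun_apply P z \<ge> 0"
    using P by (auto simp: Sym_pos_def)
  have Q_apply: "blinfun_apply Q x = blinfun_apply P x - ((u \<bullet> x) / (b \<bullet> u)) *\<^sub>R u" for x
    by (simp add: Q_def blinfun.bilinear_simps)
  have bu: "b \<bullet> u \<ge> 0"
    using pos by (simp add: u_def)
  \<comment> \<open>Cauchy-Schwarz for \<open>u\<close> and \<open>b\<close> bounds the square of
    \<open>u \<bullet> u\<close> by a multiple of \<open>b \<bullet> u\<close>.\<close>
  have null: "u = 0" if "b \<bullet> u = 0"
    using Sym_pos_cauchy_schwarz[OF P, of u b] that by (simp add: u_def)
  have "Q \<in> Sym"
    unfolding Q_def
    by (intro subspace_diff[OF subspace_Sym] subspace_scale[OF subspace_Sym] symP dyad_self_in_Sym)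
  moreover have "x \<bullet> blinfun_apply Q x \<ge> 0" for x
  proof (cases "b \<bullet> u = 0")
    case True
    then show ?thesis
      using pos by (simp add: Q_apply)
  next
    case False
    \<comment> \<open>After multiplication by \<open>b \<bullet> u > 0\<close> this is
      Cauchy-Schwarz for \<open>x\<close> and \<open>b\<close>.\<close>
    then show ?thesis
      using bu Sym_pos_cauchy_schwarz[OF P, of x b]
      by (simp add: Q_apply inner_simps u_def[symmetric] field_simps power2_eq_square inner_commute)
  qed
  ultimately show "Q \<in> Sym_pos"
    by (simp add: Sym_pos_def)
  show "blinfun_apply Q b = 0"
    using null by (cases "b \<bullet> u = 0") (auto simp: Q_apply u_def[symmetric] inner_commute)
  show "blinfun_apply Q x = 0" if "blinfun_apply P x = 0" for x
  proof -
    have "u \<bullet> x = 0"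
      using symP that by (simp add: Sym_iff u_def)
    then show ?thesis
      using that by (simp add: Q_apply)
  qed
qed

lemma Sym_pos_inner_Sym_neg_le:
  assumes "P \<in> Sym_pos" and Y: "Y \<in> Sym_neg"
  shows "P \<bullet>\<^sub>T Y \<le> 0"
proof -
  \<comment> \<open>Induction on the set \<open>S\<close> of basis vectors not yet eliminated. Each
    step kills one more basis vector and keeps those already killed, until the tensor vanishes on
    the whole basis.\<close>
  have "P \<bullet>\<^sub>T Y \<le> 0" if "finite S" "P \<in> Sym_pos" "\<forall>b\<in>Basis - S. blinfun_apply P b = 0" for S P
    using that
  proof (induction S arbitrary: P rule: finite_induct)
    case empty
    then show ?case
      by (simp add: tensor_inner_alt)
  next
    case (insert b S)
    define u where "u = blinfun_apply P b"
    define Q where "Q = P - (1 / (b \<bullet> u)) *\<^sub>R dyad u u"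
    note elim = Sym_pos_eliminate[OF insert.prems(1), where b = b, folded u_def, folded Q_def]
    have "Q \<bullet>\<^sub>T Y \<le> 0"
      using insert.prems(2) elim by (intro insert.IH) auto
    moreover have "(1 / (b \<bullet> u)) * (u \<bullet> blinfun_apply Y u) \<le> 0"
      using insert.prems(1) Y
      by (intro mult_nonneg_nonpos) (auto simp: Sym_pos_def Sym_neg_def u_def)
    moreover have "P \<bullet>\<^sub>T Y = Q \<bullet>\<^sub>T Y + (1 / (b \<bullet> u)) * (u \<bullet> blinfun_apply Y u)"
      by (simp add: Q_def tensor_inner_simps tensor_inner_commute[of "dyad u u"] tensor_inner_dyad)
    ultimately show ?case
      by linarith
  qed
  from this[OF finite_Basis] show ?thesis
    using assms by simp
qed

lemma Sym_pos_iff_polar: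
  assumes "P \<in> Sym"
  shows "P \<in> Sym_pos \<longleftrightarrow> (\<forall>Y\<in>Sym_neg. P \<bullet>\<^sub>T Y \<le> 0)"
proof
  assume polar: "\<forall>Y\<in>Sym_neg. P \<bullet>\<^sub>T Y \<le> 0"
  have "x \<bullet> blinfun_apply P x \<ge> 0" for x
  proof -
    \<comment> \<open>The test tensor \<open>- x x^T\<close> turns the polar condition into the sign
      of the form of \<open>P\<close> at \<open>x\<close>.\<close>
    have "(-1) *\<^sub>R dyad x x \<in> Sym_neg"
      using subspace_scale[OF subspace_Sym dyad_self_in_Sym, of "-1" x]
      by (simp add: Sym_neg_def blinfun.bilinear_simps inner_commute)
    then have "P \<bullet>\<^sub>T ((-1) *\<^sub>R dyad x x) \<le> 0"
      using polar by blast
    then show ?thesis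
      by (simp only: tensor_inner_simps tensor_inner_dyad)
  qed
  then show "P \<in> Sym_pos"
    using assms by (simp add: Sym_pos_def)
qed (blast intro: Sym_pos_inner_Sym_neg_le)

section \<open>Continuity and coercivity of fourth-order tensors\<close>

text \<open>The sum is the symmetric part of \<open>A\<close>. Plain dyads would not do:
  \<open>C\<close> is linear only on \<open>Sym\<close>, so every summand has to lie there.\<close>

lemma Sym_dyad_expansion:
  assumes "A \<in> Sym"
  shows "A = (\<Sum>(i,j)\<in>Basis \<times> Basis. (blinfun_apply A i \<bullet> j) *\<^sub>R (1/2) *\<^sub>R (dyad i j + dyad j i))"
    (is "A = ?E")
proof (rule blinfun_euclidean_eqI)
  fix b :: 'a assume b: "b \<in> Basis"
  have "blinfun_apply ?E b = (1/2) *\<^sub>R (\<Sum>i\<in>Basis. \<Sum>j\<in>Basis. (blinfun_apply A i \<bullet> j) *\<^sub>R (j \<bullet> b) *\<^sub>R i)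
      + (1/2) *\<^sub>R (\<Sum>i\<in>Basis. \<Sum>j\<in>Basis. (blinfun_apply A i \<bullet> j) *\<^sub>R (i \<bullet> b) *\<^sub>R j)"
    by (simp add: blinfun.sum_left blinfun.bilinear_simps sum.cartesian_product
        scaleR_sum_right scaleR_right_distrib sum.distrib case_prod_unfold mult.commute)
  also have "(\<Sum>i\<in>Basis. \<Sum>j\<in>Basis. (blinfun_apply A i \<bullet> j) *\<^sub>R (j \<bullet> b) *\<^sub>R i)
      = (\<Sum>i\<in>Basis. (blinfun_apply A i \<bullet> b) *\<^sub>R i)"
    using b by (intro sum.cong refl)
      (simp add: inner_Basis if_distrib[of "\<lambda>r. r *\<^sub>R _"] if_distrib[of "\<lambda>r. _ *\<^sub>R r"] sum.delta cong: if_cong)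
  also have "\<dots> = blinfun_apply A b"
    using assms euclidean_representation[of "blinfun_apply A b"]
    by (simp add: Sym_iff inner_commute)
  also have "(\<Sum>i\<in>Basis. \<Sum>j\<in>Basis. (blinfun_apply A i \<bullet> j) *\<^sub>R (i \<bullet> b) *\<^sub>R j)
      = (\<Sum>j\<in>Basis. (blinfun_apply A b \<bullet> j) *\<^sub>R j)"
    using b by (subst sum.swap, intro sum.cong refl)
      (simp add: inner_Basis if_distrib[of "\<lambda>r. r *\<^sub>R _"] if_distrib[of "\<lambda>r. _ *\<^sub>R r"] sum.delta cong: if_cong)
  also have "\<dots> = blinfun_apply A b"
    by (rule euclidean_representation)
  finally show "blinfun_apply A b = blinfun_apply ?E b"
    by (simp add: scaleR_left_distrib[symmetric])
qed

context
  fixes C :: "('v::euclidean_space \<Rightarrow>\<^sub>L 'v) \<Rightarrow> ('v \<Rightarrow>\<^sub>L 'v)"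
  assumes C: "fourth_order_tensor C"
begin

lemma tensor4_in_Sym: "A \<in> Sym \<Longrightarrow> C A \<in> Sym"
  using C by (simp add: fourth_order_tensor_def)

lemma tensor4_add: "A \<in> Sym \<Longrightarrow> B \<in> Sym \<Longrightarrow> C (A + B) = C A + C B"
  using C by (simp add: fourth_order_tensor_def)

lemma tensor4_scaleR: "A \<in> Sym \<Longrightarrow> C (r *\<^sub>R A) = r *\<^sub>R C A"
  using C by (simp add: fourth_order_tensor_def)

lemma tensor4_diff: "A \<in> Sym \<Longrightarrow> B \<in> Sym \<Longrightarrow> C (A - B) = C A - C B"
  using tensor4_add[of "A - B" B] subspace_diff[OF subspace_Sym, of A B] by simp

lemma tensor4_sum: "(\<And>i. i \<in> I \<Longrightarrow> f i \<in> Sym) \<Longrightarrow> C (\<Sum>i\<in>I. f i) = (\<Sum>i\<in>I. C (f i))"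
proof (induction I rule: infinite_finite_induct)
  case (insert i I)
  then show ?case
    by (simp add: tensor4_add subspace_sum[OF subspace_Sym])
qed (use tensor4_scaleR[of 0 0] subspace_0[OF subspace_Sym] in auto)

text \<open>Linearity on \<open>Sym\<close> carries \<open>C\<close> through the expansion into
  symmetrized dyads, so that \<open>A\<close> enters only through its continuous matrix
  entries.\<close>

lemma continuous_on_tensor4: "continuous_on Sym C"
proof -
  let ?S = "\<lambda>i j. (1/2) *\<^sub>R (dyad i j + dyad j i) :: 'v \<Rightarrow>\<^sub>L 'v"
  have S: "?S i j \<in> Sym" for i j
    by (simp add: Sym_iff blinfun.bilinear_simps inner_simps inner_commute)
  have "C A = (\<Sum>(i,j)\<in>Basis \<times> Basis. (blinfun_apply A i \<bullet> j) *\<^sub>R C (?S i j))" if "A \<in> Sym" for A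
  proof -
    have "C A = C (\<Sum>p\<in>Basis \<times> Basis. (blinfun_apply A (fst p) \<bullet> snd p) *\<^sub>R ?S (fst p) (snd p))"
      using Sym_dyad_expansion[OF that] by (simp add: case_prod_unfold)
    also have "\<dots> = (\<Sum>p\<in>Basis \<times> Basis. (blinfun_apply A (fst p) \<bullet> snd p) *\<^sub>R C (?S (fst p) (snd p)))"
      using S by (simp only: tensor4_sum tensor4_scaleR subspace_scale[OF subspace_Sym])
    finally show ?thesis
      by (simp add: case_prod_unfold)
  qed
  moreover have "continuous_on Sym
      (\<lambda>A. \<Sum>(i,j)\<in>Basis \<times> Basis. (blinfun_apply A i \<bullet> j) *\<^sub>R C (?S i j))"
    unfolding case_prod_unfold by (intro continuous_intros)
  ultimately show ?thesis
    by (simp cong: continuous_on_cong)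
qed

text \<open>Take for \<open>m\<close> the minimum of the quadratic form over the unit sphere of
  \<open>Sym\<close>; homogeneity of degree two extends the bound to all of
  \<open>Sym\<close>.\<close>

lemma tensor4_coercive:
  assumes "positive_definite_tensor4 C"
  obtains m where "m > 0" "\<And>A. A \<in> Sym \<Longrightarrow> A \<bullet>\<^sub>T C A \<ge> m * (norm A)\<^sup>2"
proof (cases "Sym \<inter> sphere 0 1 = ({} :: ('v \<Rightarrow>\<^sub>L 'v) set)")
  \<comment> \<open>Attaining a minimum requires a nonempty set. If the sphere misses
    \<open>Sym\<close>, then \<open>Sym\<close> is trivial and any positive \<open>m\<close>
    serves.\<close>
  case True
  have trivial: "A = 0" if "A \<in> Sym" for A :: "'v \<Rightarrow>\<^sub>L 'v"
  proof (rule ccontr)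
    assume "A \<noteq> 0"
    then have "(1 / norm A) *\<^sub>R A \<in> Sym \<inter> sphere 0 1"
      using that by (simp add: subspace_scale[OF subspace_Sym])
    then show False
      using True by blast
  qed
  show thesis
    by (rule that[of 1]) (auto simp: tensor_inner_alt dest!: trivial)
next
  case False
  have "compact (Sym \<inter> sphere 0 1 :: ('v \<Rightarrow>\<^sub>L 'v) set)"
  proof (rule compact_eq_bounded_closed[THEN iffD2], intro conjI)
    show "bounded (Sym \<inter> sphere 0 1 :: ('v \<Rightarrow>\<^sub>L 'v) set)"
      by (rule bounded_subset[OF bounded_cball[of 0 1]]) auto
    have "(sphere 0 1 :: ('v \<Rightarrow>\<^sub>L 'v) set) = {A. norm A = 1}"
      by auto
    then have "closed (sphere 0 1 :: ('v \<Rightarrow>\<^sub>L 'v) set)"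
      by (simp add: closed_Collect_eq continuous_on_norm_id)
    then show "closed (Sym \<inter> sphere 0 1 :: ('v \<Rightarrow>\<^sub>L 'v) set)"
      by (intro closed_Int closed_Sym)
  qed
  moreover have "continuous_on (Sym \<inter> sphere 0 1) (\<lambda>A. A \<bullet>\<^sub>T C A)"
    by (intro continuous_intros continuous_on_subset[OF continuous_on_tensor4]) auto
  ultimately obtain U where U: "U \<in> Sym \<inter> sphere 0 1"
    and min: "\<And>A. A \<in> Sym \<inter> sphere 0 1 \<Longrightarrow> U \<bullet>\<^sub>T C U \<le> A \<bullet>\<^sub>T C A"
    using continuous_attains_inf[OF _ False, of "\<lambda>A. A \<bullet>\<^sub>T C A"] by auto
  have "U \<bullet>\<^sub>T C U > 0"
    using U assms by (auto simp: positive_definite_tensor4_def)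
  moreover have "A \<bullet>\<^sub>T C A \<ge> (U \<bullet>\<^sub>T C U) * (norm A)\<^sup>2" if A: "A \<in> Sym" for A
  proof (cases "A = 0")
    case False
    have "(1 / norm A) *\<^sub>R A \<in> Sym \<inter> sphere 0 1"
      using A False by (simp add: subspace_scale[OF subspace_Sym])
    from min[OF this] have "U \<bullet>\<^sub>T C U \<le> (A \<bullet>\<^sub>T C A) / (norm A)\<^sup>2"
      by (simp only: tensor4_scaleR[OF A] tensor_inner_simps) (simp add: power2_eq_square)
    then show ?thesis
      using False by (simp add: field_simps)
  qed (simp add: tensor_inner_alt)
  ultimately show thesis
    by (rule that)
qed

section \<open>The minimization problem\<close>

text \<open>Exact second-order expansion of \<open>phi\<close> at \<open>Ys\<close>, from writing
  \<open>D - Y\<close> as \<open>(D - Ys) - (Y - Ys)\<close>; symmetry of \<open>C\<close> merges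
  the two mixed terms. The linear term is the one in the variational inequality.\<close>

lemma phi_diff:
  assumes sym: "symmetric_tensor4 C" and "D \<in> Sym" "Y \<in> Sym" "Ys \<in> Sym"
  shows "phi C D Y - phi C D Ys = (Y - Ys) \<bullet>\<^sub>T C (Y - Ys) - 2 * (C (D - Ys) \<bullet>\<^sub>T (Y - Ys))"
proof -
  have mem: "D - Ys \<in> Sym" "Y - Ys \<in> Sym"
    using assms subspace_diff[OF subspace_Sym] by auto
  have "phi C D Y = ((D - Ys) - (Y - Ys)) \<bullet>\<^sub>T C ((D - Ys) - (Y - Ys))"
    by (simp add: phi_def)
  also have "\<dots> = phi C D Ys - (D - Ys) \<bullet>\<^sub>T C (Y - Ys) - (Y - Ys) \<bullet>\<^sub>T C (D - Ys)
      + (Y - Ys) \<bullet>\<^sub>T C (Y - Ys)"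
    by (simp only: tensor4_diff[OF mem] tensor_inner_diff_left[of "D - Ys" "Y - Ys"]
        tensor_inner_diff_right[of _ "C (D - Ys)" "C (Y - Ys)"] phi_def)
  also have "(D - Ys) \<bullet>\<^sub>T C (Y - Ys) = (Y - Ys) \<bullet>\<^sub>T C (D - Ys)"
    using sym mem by (simp add: symmetric_tensor4_def)
  finally show ?thesis
    by (simp add: tensor_inner_commute)
qed

text \<open>\<open>Sym_neg\<close> is closed but unbounded; coercivity allows restricting the search
  to a ball around \<open>D\<close>.\<close>

lemma minimizer_exists:
  assumes pd: "positive_definite_tensor4 C" and D: "D \<in> Sym"
  obtains Ys where "Ys \<in> Sym_neg" "is_minimizer C D Ys"
proof -
  obtain m where m: "m > 0" "\<And>A. A \<in> Sym \<Longrightarrow> A \<bullet>\<^sub>T C A \<ge> m * (norm A)\<^sup>2"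
    using tensor4_coercive[OF pd] by blast
  \<comment> \<open>Beyond this radius the coercive lower bound exceeds \<open>phi C D 0\<close>, so
    \<open>0\<close> is a better competitor.\<close>
  define K where "K = Sym_neg \<inter> cball D (sqrt (phi C D 0 / m))"
  have outside: "phi C D 0 < phi C D Y" if "Y \<in> Sym_neg - K" for Y
  proof -
    have "sqrt (phi C D 0 / m) < norm (D - Y)"
      using that by (auto simp: K_def dist_norm)
    then have "phi C D 0 / m < (norm (D - Y))\<^sup>2"
      by (meson not_le real_le_rsqrt)
    then have "phi C D 0 < m * (norm (D - Y))\<^sup>2"
      using m(1) by (simp add: field_simps)
    also have "\<dots> \<le> phi C D Y"
      unfolding phi_def using that D
      by (intro m(2) subspace_diff[OF subspace_Sym]) (auto intro: Sym_neg_imp_Sym)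
    finally show ?thesis .
  qed
  \<comment> \<open>Otherwise \<open>outside\<close> would say that \<open>phi C D 0\<close> is less
    than itself.\<close>
  have "0 \<in> K"
    using outside[of 0] zero_in_Sym_neg by blast
  moreover have "compact K"
    unfolding K_def
    by (intro compact_eq_bounded_closed[THEN iffD2] conjI closed_Int closed_Sym_neg closed_cball
        bounded_Int disjI2 bounded_cball)
  moreover have "continuous_on K (\<lambda>Y. phi C D Y)"
    unfolding phi_def
    using D
    by (intro continuous_intros continuous_on_compose2[OF continuous_on_tensor4])
      (auto simp: K_def intro: subspace_diff[OF subspace_Sym] Sym_neg_imp_Sym)
  ultimately obtain Ys where Ys: "Ys \<in> K" and min: "\<And>Y. Y \<in> K \<Longrightarrow> phi C D Ys \<le> phi C D Y"
    using continuous_attains_inf[of K "phi C D"] by auto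
  have "phi C D Ys \<le> phi C D Y" if "Y \<in> Sym_neg" for Y
    using that min[of Y] min[OF \<open>0 \<in> K\<close>] outside[of Y] by fastforce
  then show thesis
    using Ys that by (auto simp: K_def is_minimizer_def)
qed

text \<open>Both directions read off \<open>phi_diff\<close>: on a short segment from
  \<open>Ys\<close> towards \<open>Y\<close> the linear term dominates, and conversely the quadratic
  term is nonnegative.\<close>

lemma minimizer_iff_variational:
  assumes "symmetric_tensor4 C" and pd: "positive_definite_tensor4 C"
    and "D \<in> Sym" and Ys: "Ys \<in> Sym_neg"
  shows "is_minimizer C D Ys \<longleftrightarrow> solves_variational_inequality C D Ys"
proof
  assume min: "is_minimizer C D Ys"
  have "C (D - Ys) \<bullet>\<^sub>T (Y - Ys) \<le> 0" if Y: "Y \<in> Sym_neg" for Y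
  proof (rule ccontr)
    let ?a = "C (D - Ys) \<bullet>\<^sub>T (Y - Ys)" and ?q = "(Y - Ys) \<bullet>\<^sub>T C (Y - Ys)"
    assume "\<not> ?a \<le> 0"
    then have a: "?a > 0"
      by simp
    \<comment> \<open>\<open>t \<le> 1\<close> keeps \<open>?Z\<close> on the segment, and the other
      bound makes \<open>t * ?q\<close> at most \<open>?a\<close>, hence below
      \<open>2 * ?a\<close>. The summand 1 keeps the denominator positive.\<close>
    define t where "t = min 1 (?a / (\<bar>?q\<bar> + 1))"
    have t: "0 < t" "t \<le> 1" "t * (\<bar>?q\<bar> + 1) \<le> ?a"
      using a mult_right_mono[of t "?a / (\<bar>?q\<bar> + 1)" "\<bar>?q\<bar> + 1"] by (auto simp: t_def)
    let ?Z = "Ys + t *\<^sub>R (Y - Ys)"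
    have "?Z = (1 - t) *\<^sub>R Ys + t *\<^sub>R Y"
      by (simp add: algebra_simps)
    then have Z: "?Z \<in> Sym_neg"
      using Y Ys t by (simp add: Sym_neg_add Sym_neg_scaleR)
    have "Y - Ys \<in> Sym"
      using Y Ys by (simp add: subspace_diff[OF subspace_Sym] Sym_neg_imp_Sym)
    then have "phi C D ?Z - phi C D Ys = t * (t * ?q - 2 * ?a)"
      using phi_diff[of D ?Z Ys, unfolded add_diff_cancel_left'] assms Z
      by (simp add: Sym_neg_imp_Sym tensor4_scaleR tensor_inner_scaleR_left tensor_inner_scaleR_right
          right_diff_distrib)
    moreover have "t * ?q \<le> t * (\<bar>?q\<bar> + 1)"
      using t by (intro mult_left_mono) auto
    then have "t * ?q < 2 * ?a"
      using t a by linarith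
    then have "t * (t * ?q - 2 * ?a) < 0"
      using t(1) by (simp add: mult_pos_neg)
    ultimately show False
      using min Z by (auto simp: is_minimizer_def dest!: bspec)
  qed
  then show "solves_variational_inequality C D Ys"
    by (simp add: solves_variational_inequality_def)
next
  assume vi: "solves_variational_inequality C D Ys"
  have "phi C D Ys \<le> phi C D Y" if "Y \<in> Sym_neg" for Y
  proof -
    have "Y - Ys \<in> Sym"
      using that Ys by (simp add: subspace_diff[OF subspace_Sym] Sym_neg_imp_Sym)
    then have "(Y - Ys) \<bullet>\<^sub>T C (Y - Ys) \<ge> 0"
      using pd by (cases "Y - Ys = 0") (auto simp: positive_definite_tensor4_def tensor_inner_alt less_imp_le)
    moreover have "C (D - Ys) \<bullet>\<^sub>T (Y - Ys) \<le> 0"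
      using vi that by (simp add: solves_variational_inequality_def)
    ultimately show ?thesis
      using phi_diff[of D Y Ys] assms that by (simp add: Sym_neg_imp_Sym)
  qed
  then show "is_minimizer C D Ys"
    by (simp add: is_minimizer_def)
qed

lemma complementarity_iff_variational:
  assumes D: "D \<in> Sym" and Ys: "Ys \<in> Sym_neg"
  shows "solves_complementarity C D Ys \<longleftrightarrow> solves_variational_inequality C D Ys"
proof -
  let ?P = "C (D - Ys)"
  have P: "?P \<in> Sym"
    using D Ys by (simp add: tensor4_in_Sym subspace_diff[OF subspace_Sym] Sym_neg_imp_Sym)
  show ?thesis
  proof
    assume "solves_complementarity C D Ys"
    then show "solves_variational_inequality C D Ys"
      using Sym_pos_iff_polar[OF P]
      by (simp add: solves_complementarity_def solves_variational_inequality_def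
          tensor_inner_diff_right tensor_inner_commute[of Ys])
  next
    assume "solves_variational_inequality C D Ys"
    then have vi: "?P \<bullet>\<^sub>T Y \<le> ?P \<bullet>\<^sub>T Ys" if "Y \<in> Sym_neg" for Y
      using that by (simp add: solves_variational_inequality_def tensor_inner_diff_right)
    \<comment> \<open>The cone contains \<open>0\<close> and \<open>2 Ys\<close>; testing with them
      gives both signs.\<close>
    have "?P \<bullet>\<^sub>T Ys = 0"
      using vi[OF Sym_neg_scaleR[OF Ys, of 0]] vi[OF Sym_neg_scaleR[OF Ys, of 2]]
      by (simp add: tensor_inner_scaleR_right[of ?P] tensor_inner_alt[of ?P 0])
    then show "solves_complementarity C D Ys"
      using vi Sym_pos_iff_polar[OF P]
      by (simp add: solves_complementarity_def tensor_inner_commute[of Ys])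
  qed
qed

text \<open>In \<open>phi_diff\<close> at \<open>Z\<close> the variational inequality controls the
  linear term and positive definiteness makes the quadratic one strictly positive, so
  \<open>Y\<close> would have a larger value than \<open>Z\<close>.\<close>

lemma minimizer_unique:
  assumes "symmetric_tensor4 C" and pd: "positive_definite_tensor4 C" and "D \<in> Sym"
    and "Y \<in> Sym_neg" "is_minimizer C D Y" "Z \<in> Sym_neg" "is_minimizer C D Z"
  shows "Y = Z"
proof (rule ccontr)
  assume "Y \<noteq> Z"
  moreover have "Y - Z \<in> Sym"
    using assms by (simp add: subspace_diff[OF subspace_Sym] Sym_neg_imp_Sym)
  ultimately have "(Y - Z) \<bullet>\<^sub>T C (Y - Z) > 0"
    using pd by (simp add: positive_definite_tensor4_def)
  moreover have "C (D - Z) \<bullet>\<^sub>T (Y - Z) \<le> 0"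
    using assms minimizer_iff_variational[of D Z] by (simp add: solves_variational_inequality_def)
  moreover have "phi C D Y \<le> phi C D Z"
    using assms by (simp add: is_minimizer_def)
  ultimately show False
    using phi_diff[of D Y Z] assms by (simp add: Sym_neg_imp_Sym)
qed

end

theorem proposition1:
  fixes C :: "('v::euclidean_space \<Rightarrow>\<^sub>L 'v) \<Rightarrow> ('v \<Rightarrow>\<^sub>L 'v)"
    and D :: "'v \<Rightarrow>\<^sub>L 'v"
  assumes "DIM('v) = 3"
    and "fourth_order_tensor C"
    and "symmetric_tensor4 C"
    and "positive_definite_tensor4 C"
    and "D \<in> Sym"
  shows "(\<forall>Ys\<in>Sym_neg.
            (is_minimizer C D Ys \<longleftrightarrow> solves_complementarity C D Ys) \<and>
            (solves_complementarity C D Ys \<longleftrightarrow> solves_variational_inequality C D Ys)) \<and>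
         (\<exists>!Ys. Ys \<in> Sym_neg \<and> is_minimizer C D Ys \<and> solves_complementarity C D Ys \<and>
            solves_variational_inequality C D Ys)"
proof -
  have equiv: "\<forall>Ys\<in>Sym_neg.
      (is_minimizer C D Ys \<longleftrightarrow> solves_complementarity C D Ys) \<and>
      (solves_complementarity C D Ys \<longleftrightarrow> solves_variational_inequality C D Ys)"
    using assms by (simp add: minimizer_iff_variational complementarity_iff_variational)
  obtain Ys where "Ys \<in> Sym_neg" "is_minimizer C D Ys"
    using minimizer_exists assms by blast
  then show ?thesis
    using equiv by (intro conjI ex1I[of _ Ys]) (auto intro: minimizer_unique[OF assms(2-5)])
qed

end
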